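(* Let $A,B\in\mathcal{H}_n(\Gamma)$ have the same graph $G$ (that is, $G_A=G_B=G$). Suppose that $\Re_A(C_1)=\Re_A(C_2)$ and $\Re_B(C_1)=\Re_B(C_2)$ for every pair of cycles $C_1$ and $C_2$ of the same length in $G$. Then $A$ and $B$ are cospectral if and only if $\Re_A(C)=\Re_B(C)$ for each cycle $C$ in $G$.
   Context: $\Gamma\subset\mathbb{C}$ is a set such that $0\in\Gamma$ and $\Gamma\setminus\{0\}$ is a subgroup of the multiplicative group of complex numbers of unit modulus. $\mathcal{H}_n(\Gamma)$ is the set of all $n\times n$ Hermitian matrices with entries in $\Gamma$ and zero diagonal. For $A=[a_{uv}]\in\mathcal{H}_n(\Gamma)$, the graph $G_A$ of $A$ is the simple undirected graph with vertex set $\{1,\dots,n\}$ in which $u,v$ are adjacent iff $a_{uv}\neq 0$. For a cycle $C=u_1u_2\ldots u_ku_1$ in $G_A$, the gain of $C$ is $\zeta_A(C)=a_{u_1u_2}a_{u_2u_3}\cdots a_{u_{k-1}u_k}a_{u_ku_1}$, and $\Re_A(C)$ denotes the real part of $\zeta_A(C)$ (it does not depend on the starting vertex or direction of $C$). Two matrices are cospectral if they have the same multiset of eigenvalues. *)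

theory Defs
  imports
    "Jordan_Normal_Form.Schur_Decomposition"
    "Graph_Theory.Pair_Digraph"
begin

definition unit_complex_group :: "complex monoid" where
  "unit_complex_group = \<lparr>carrier = {z. cmod z = 1}, monoid.mult = (*), one = 1\<rparr>"

lemma group_unit_complex_group: "group unit_complex_group"
proof (rule groupI)
  fix z assume "z \<in> carrier unit_complex_group"
  hence "inverse z \<in> carrier unit_complex_group" "inverse z * z = 1"
    by (auto simp: unit_complex_group_def norm_inverse intro!: left_inverse)
  thus "\<exists>y\<in>carrier unit_complex_group. y \<otimes>\<^bsub>unit_complex_group\<^esub> z = \<one>\<^bsub>unit_complex_group\<^esub>"
    by (auto simp: unit_complex_group_def)
qed (auto simp: unit_complex_group_def norm_mult)

definition gain_set :: "complex set \<Rightarrow> bool" where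
  "gain_set \<Gamma> \<longleftrightarrow> 0 \<in> \<Gamma> \<and> subgroup (\<Gamma> - {0}) unit_complex_group"

definition hermitian_mats :: "nat \<Rightarrow> complex set \<Rightarrow> complex mat set" where
  "hermitian_mats n \<Gamma> = {A \<in> carrier_mat n n.
     mat_adjoint A = A \<and> elements_mat A \<subseteq> \<Gamma> \<and> (\<forall>u<n. A $$ (u, u) = 0)}"

(* Vertices are the matrix indices, i.e. {0..<n} rather than {1..n}.  A simple undirected graph is
   represented, as in Pair_Digraph, by the finite loop-free symmetric digraph (pair_graph) that
   contains both orientations of every edge. *)
definition graph_of_mat :: "complex mat \<Rightarrow> nat pair_pre_digraph" where
  "graph_of_mat A = \<lparr>pverts = {0..<dim_row A},
     parcs = {(u, v). u < dim_row A \<and> v < dim_col A \<and> A $$ (u, v) \<noteq> 0}\<rparr>"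

(* The cycle u1 u2 ... uk u1 is given by its list of arcs [(u1,u2), ..., (uk,u1)]; each traversal
   (starting vertex and direction) is a separate list.  The predicate pre_digraph.cycle also admits
   the closed walk [(u,v), (v,u)], which is not a cycle of a simple graph; hence the lower bound on
   the length. *)
definition graph_cycle :: "'a pair_pre_digraph \<Rightarrow> ('a \<times> 'a) list \<Rightarrow> bool" where
  "graph_cycle G C \<longleftrightarrow> pre_digraph.cycle (with_proj G) C \<and> 3 \<le> length C"

definition cycle_gain :: "complex mat \<Rightarrow> (nat \<times> nat) list \<Rightarrow> complex" where
  "cycle_gain A C = (\<Prod>e\<leftarrow>C. A $$ e)"

(* Eigenvalues counted with algebraic multiplicity. *)
definition eigenvalue_mset :: "complex mat \<Rightarrow> complex multiset" where
  "eigenvalue_mset A = proots (char_poly A)"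

definition cospectral :: "complex mat \<Rightarrow> complex mat \<Rightarrow> bool" where
  "cospectral A B \<longleftrightarrow> eigenvalue_mset A = eigenvalue_mset B"

lemma hermitian_mats_entry:
  assumes "A \<in> hermitian_mats n \<Gamma>" "u < n" "v < n"
  shows "A $$ (v, u) = cnj (A $$ (u, v))"
proof -
  have c: "A \<in> carrier_mat n n" and h: "mat_adjoint A = A"
    using assms(1) by (auto simp: hermitian_mats_def)
  have "A $$ (v, u) = mat_adjoint A $$ (v, u)" using h by simp
  also have "\<dots> = cnj (A $$ (u, v))"
    using c assms(2,3) unfolding mat_adjoint_def by (auto simp: mat_of_rows_def)
  finally show ?thesis .
qed

lemma pair_graph_graph_of_mat:
  assumes "A \<in> hermitian_mats n \<Gamma>"
  shows "pair_graph (graph_of_mat A)"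
proof -
  have c: "dim_row A = n" "dim_col A = n" and d: "\<forall>u<n. A $$ (u, u) = 0"
    using assms by (auto simp: hermitian_mats_def)
  have fin: "finite (parcs (graph_of_mat A))"
    by (rule finite_subset[of _ "{0..<n} \<times> {0..<n}"]) (auto simp: graph_of_mat_def c)
  have "A $$ (v, u) \<noteq> 0" if "u < n" "v < n" "A $$ (u, v) \<noteq> 0" for u v
    unfolding hermitian_mats_entry[OF assms that(1,2)] using that(3) by simp
  hence sym: "symmetric (with_proj (graph_of_mat A))"
    by (auto simp: symmetric_def sym_def graph_of_mat_def c)
  show ?thesis
    by unfold_locales (use fin sym d in \<open>auto simp: graph_of_mat_def c\<close>)
qed

end

theory Submission
  imports Defs
begin

text \<open>
  Fix a vertex \<open>v\<close> and group the permutations in the determinant \<open>det (x I - A)\<close> by their cycle through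
  \<open>v\<close>. Write \<open>P S\<close> for the characteristic polynomial of the principal submatrix on \<open>S\<close>.
  For a set \<open>T\<close> of vertices other than \<open>v\<close>, the grouping gives the recursion

    \<open>P (insert v T) = x * P T - (\<Sum>c. gain c * P (T - c))\<close>,

  where \<open>c\<close> ranges over the directed cycles through \<open>v\<close>, digons (single edges) included. The cofactor
  \<open>P (T - c)\<close> does not depend on the direction of \<open>c\<close>, and reversing \<open>c\<close> conjugates its gain; hence each
  gain may be replaced by its real part (\<open>char_subpoly_insert_Re\<close>). Working with this recursion
  replaces the classical sum over elementary subgraphs, that is, over sets of disjoint
  edges and cycles.

  Since \<open>P S\<close> is monic of degree \<open>card S\<close>, a cycle of length \<open>k\<close> affects \<open>P S\<close> only in degrees up to
  \<open>card S - k\<close>, and its effect in degree \<open>card S - k\<close> is minus the real part of its gain. So if the real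
  parts for \<open>A\<close> and \<open>B\<close> agree on all cycles shorter than \<open>k\<close>, then the coefficients above that degree
  agree (\<open>coeff_char_subpoly_eq_if_short_cycles_agree\<close>). If moreover they differ by the same \<open>d\<close> on all
  cycles of length \<open>k\<close>, the coefficients in degree \<open>card S - k\<close> differ by \<open>- N * d\<close>, where \<open>N > 0\<close> as soon as
  there is a cycle of length \<open>k\<close> in \<open>S\<close> (\<open>coeff_char_subpoly_diff\<close>).

  Digons have gain 1 on every edge, for \<open>A\<close> and for \<open>B\<close>. If the real parts agree on all cycles,
  the first fact with \<open>k = n + 1\<close> shows that the characteristic polynomials coincide. Conversely, the
  second fact with \<open>N * d = 0\<close> yields \<open>d = 0\<close>, by induction on the length of the cycle.
\<close>

section \<open>Expansion of determinants along the cycles through a vertex\<close>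

definition subdet :: "('b \<times> 'b \<Rightarrow> 'a::comm_ring_1) \<Rightarrow> 'b set \<Rightarrow> 'a" where
  "subdet M S = (\<Sum>p | p permutes S. of_int (sign p) * (\<Prod>i\<in>S. M (i, p i)))"

text \<open>
  Up to sign this is the minor with rows \<open>insert u T\<close> and columns \<open>insert v T\<close>: a permutation of
  \<open>insert u T\<close> is read as a bijection onto \<open>insert v T\<close> by letting column \<open>v\<close> stand in for \<open>u\<close>.
  For \<open>u = v\<close> it is the principal minor on \<open>insert v T\<close>, and its expansion along row \<open>u\<close> stays in
  this class of minors.
\<close>

definition shifted_minor :: "('b \<times> 'b \<Rightarrow> 'a::comm_ring_1) \<Rightarrow> 'b set \<Rightarrow> 'b \<Rightarrow> 'b \<Rightarrow> 'a" where
  "shifted_minor M T u v = (\<Sum>p | p permutes insert u T.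
     of_int (sign p) * (\<Prod>i\<in>insert u T. M (i, if p i = u then v else p i)))"

text \<open>
  The cycle \<open>v, ws, v\<close> is \<open>path_arcs v ws v\<close>. The end point is kept apart from the start because the
  expansion of a minor builds the cycle one arc at a time.
\<close>

fun path_arcs :: "'b \<Rightarrow> 'b list \<Rightarrow> 'b \<Rightarrow> ('b \<times> 'b) list" where
  "path_arcs u [] v = [(u, v)]"
| "path_arcs u (w # ws) v = (u, w) # path_arcs w ws v"

definition weight :: "('b \<times> 'b \<Rightarrow> 'a::comm_monoid_mult) \<Rightarrow> ('b \<times> 'b) list \<Rightarrow> 'a" where
  "weight M p = (\<Prod>e\<leftarrow>p. M e)"

definition simple_lists :: "'b set \<Rightarrow> 'b list set" where
  "simple_lists T = {ws. distinct ws \<and> set ws \<subseteq> T}"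

lemma shifted_minor_same: "shifted_minor M T v v = subdet M (insert v T)"
  unfolding shifted_minor_def subdet_def
  by (intro sum.cong refl arg_cong2[where f = "(*)"] prod.cong) auto

text \<open>
  Expansion along row \<open>u\<close>. A permutation \<open>p\<close> of \<open>insert u T\<close> is uniquely \<open>transpose u b \<circ> q\<close> with
  \<open>q\<close> a permutation of \<open>T\<close> and \<open>b = p u\<close>. If \<open>b = u\<close>, the path closes with the arc \<open>(u, v)\<close> and the
  principal minor on \<open>T\<close> is left over. Otherwise the path moves on to \<open>b\<close>, at the price of a
  sign, and the index that \<open>q\<close> maps to \<open>b\<close> is now sent to column \<open>v\<close>.
\<close>

lemma shifted_minor_rec:
  assumes fin: "finite T" and u: "u \<notin> T"
  shows "shifted_minor M T u v =
    M (u, v) * subdet M T - (\<Sum>w\<in>T. M (u, w) * shifted_minor M (T - {w}) w v)"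
proof -
  define f where "f p = of_int (sign p) *
      (\<Prod>i\<in>insert u T. M (i, if p i = u then v else p i))" for p :: "'a \<Rightarrow> 'a"
  have f_comp: "f (transpose u b \<circ> q) = of_int (sign (transpose u b)) * of_int (sign q) *
      (M (u, if b = u then v else b) *
        (\<Prod>i\<in>T. M (i, if q i = b then v else q i)))"
    if q: "q permutes T" and b: "b \<in> insert u T" for b q
  proof -
    have qu: "q u = u" using q u by (simp add: permutes_not_in)
    have "(\<Prod>i\<in>T. M (i, if (transpose u b \<circ> q) i = u then v else (transpose u b \<circ> q) i)) =
      (\<Prod>i\<in>T. M (i, if q i = b then v else q i))"
    proof (rule prod.cong[OF refl])
      fix i assume "i \<in> T"
      hence "q i \<noteq> u" using permutes_in_image[OF q] u by metis
      thus "M (i, if (transpose u b \<circ> q) i = u then v else (transpose u b \<circ> q) i) =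
            M (i, if q i = b then v else q i)"
        by (auto simp: transpose_def)
    qed
    moreover have "permutation q"
      using q fin by (auto simp: permutation_permutes)
    moreover have "permutation (transpose u b)"
      by (rule permutation_swap_id)
    ultimately show ?thesis
      using u fin qu by (simp add: f_def sign_compose del: o_apply) simp
  qed
  have "shifted_minor M T u v = (\<Sum>p | p permutes insert u T. f p)"
    by (simp add: shifted_minor_def f_def)
  also have "\<dots> = (\<Sum>b\<in>insert u T. \<Sum>q | q permutes T. f (transpose u b \<circ> q))"
    by (rule sum_over_permutations_insert[OF fin u])
  also have "\<dots> = (\<Sum>q | q permutes T. f (transpose u u \<circ> q)) +
      (\<Sum>b\<in>T. \<Sum>q | q permutes T. f (transpose u b \<circ> q))"
    using fin u by simp
  also have "(\<Sum>q | q permutes T. f (transpose u u \<circ> q)) = M (u, v) * subdet M T"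
    unfolding subdet_def sum_distrib_left
  proof (rule sum.cong[OF refl])
    fix q assume "q \<in> {q. q permutes T}"
    hence q: "q permutes T" by simp
    have "(\<Prod>i\<in>T. M (i, if q i = u then v else q i)) = (\<Prod>i\<in>T. M (i, q i))"
      using permutes_in_image[OF q] u by (intro prod.cong) auto
    thus "f (transpose u u \<circ> q) = M (u, v) * (of_int (sign q) * (\<Prod>i\<in>T. M (i, q i)))"
      unfolding f_comp[OF q insertI1] by (simp add: sign_swap_id ac_simps)
  qed
  also have "(\<Sum>b\<in>T. \<Sum>q | q permutes T. f (transpose u b \<circ> q)) =
      (\<Sum>b\<in>T. - (M (u, b) * shifted_minor M (T - {b}) b v))"
  proof (rule sum.cong[OF refl])
    fix b assume b: "b \<in> T"
    have [simp]: "insert b T = T" "u \<noteq> b" "b \<noteq> u" using b u by auto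
    show "(\<Sum>q | q permutes T. f (transpose u b \<circ> q)) =
        - (M (u, b) * shifted_minor M (T - {b}) b v)"
      using b by (simp add: shifted_minor_def f_comp sum_distrib_left sign_swap_id
          sum_negf mult.assoc mult.left_commute)
  qed
  finally show ?thesis by (simp add: sum_negf)
qed

lemma finite_simple_lists [simp]: "finite T \<Longrightarrow> finite (simple_lists T)"
  unfolding simple_lists_def
  by (rule finite_subset[OF _ finite_subset_distinct]) auto

lemma Nil_in_simple_lists [simp]: "[] \<in> simple_lists T"
  by (simp add: simple_lists_def)

lemma sum_simple_lists:
  assumes "finite T"
  shows "(\<Sum>ws\<in>simple_lists T. f ws) =
    f [] + (\<Sum>w\<in>T. \<Sum>ws\<in>simple_lists (T - {w}). f (w # ws))"
proof -
  have eq: "simple_lists T =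
      insert [] ((\<lambda>(w, ws). w # ws) ` (SIGMA w:T. simple_lists (T - {w})))"
  proof (rule Set.set_eqI)
    fix xs
    show "xs \<in> simple_lists T \<longleftrightarrow>
        xs \<in> insert [] ((\<lambda>(w, ws). w # ws) ` (SIGMA w:T. simple_lists (T - {w})))"
      by (cases xs) (auto simp: simple_lists_def image_iff)
  qed
  have "(\<Sum>ws\<in>simple_lists T. f ws) =
      f [] + (\<Sum>ws\<in>(\<lambda>(w, ws). w # ws) ` (SIGMA w:T. simple_lists (T - {w})). f ws)"
    unfolding eq using assms by (subst sum.insert) auto
  also have "(\<Sum>ws\<in>(\<lambda>(w, ws). w # ws) ` (SIGMA w:T. simple_lists (T - {w})). f ws) =
      (\<Sum>(w, ws)\<in>(SIGMA w:T. simple_lists (T - {w})). f (w # ws))"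
    by (subst sum.reindex) (auto simp: inj_on_def intro!: sum.cong)
  finally show ?thesis
    using assms by (simp add: sum.Sigma)
qed

lemma shifted_minor_eq_sum_paths:
  assumes "finite T" "u \<notin> T"
  shows "shifted_minor M T u v = (\<Sum>ws\<in>simple_lists T.
    (-1) ^ length ws * weight M (path_arcs u ws v) * subdet M (T - set ws))"
  using assms
proof (induction "card T" arbitrary: T u rule: less_induct)
  case less
  have IH: "shifted_minor M (T - {w}) w v = (\<Sum>ws\<in>simple_lists (T - {w}).
      (-1) ^ length ws * weight M (path_arcs w ws v) * subdet M (T - {w} - set ws))"
    if "w \<in> T" for w
    by (rule less.hyps) (use that less.prems in \<open>auto simp del: card_Diff_insert intro: card_Diff1_less\<close>)
  have step: "(\<Sum>ws\<in>simple_lists (T - {w}). (-1) ^ length (w # ws) *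
      weight M (path_arcs u (w # ws) v) * subdet M (T - set (w # ws))) =
      - (M (u, w) * shifted_minor M (T - {w}) w v)" if w: "w \<in> T" for w
    unfolding IH[OF w] sum_distrib_left sum_negf[symmetric]
  proof (rule sum.cong[OF refl])
    fix ws
    have "T - set (w # ws) = T - {w} - set ws" by auto
    thus "(-1) ^ length (w # ws) * weight M (path_arcs u (w # ws) v) * subdet M (T - set (w # ws)) =
        - (M (u, w) * ((-1) ^ length ws * weight M (path_arcs w ws v) *
            subdet M (T - {w} - set ws)))"
      by (simp only:) (simp add: weight_def mult_ac)
  qed
  have "(\<Sum>w\<in>T. \<Sum>ws\<in>simple_lists (T - {w}). (-1) ^ length (w # ws) *
      weight M (path_arcs u (w # ws) v) * subdet M (T - set (w # ws))) =
      - (\<Sum>w\<in>T. M (u, w) * shifted_minor M (T - {w}) w v)"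
    unfolding sum_negf[symmetric] by (rule sum.cong[OF refl step])
  thus ?case
    unfolding shifted_minor_rec[OF less.prems] sum_simple_lists[OF less.prems(1)]
    by (simp only:) (simp add: weight_def)
qed

text \<open>
  The permutations are grouped by their cycle through \<open>v\<close>. The factor \<open>subdet M (T - set ws)\<close> only
  depends on the vertex set of that cycle, which is what makes it possible to pair a cycle with its
  reversal.
\<close>

lemma subdet_insert_eq_sum_cycles:
  assumes "finite T" "v \<notin> T"
  shows "subdet M (insert v T) = (\<Sum>ws\<in>simple_lists T.
    (-1) ^ length ws * weight M (path_arcs v ws v) * subdet M (T - set ws))"
  using shifted_minor_eq_sum_paths[OF assms, of M v] by (simp add: shifted_minor_same)

section \<open>Characteristic polynomials of principal submatrices\<close>

definition char_entry :: "('b \<times> 'b \<Rightarrow> 'a::comm_ring_1) \<Rightarrow> 'b \<times> 'b \<Rightarrow> 'a poly" where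
  "char_entry a e = (if fst e = snd e then [:0, 1:] else 0) - [:a e:]"

text \<open>
  The characteristic polynomial of the principal submatrix with index set \<open>S\<close>. Matrices are
  functions on index pairs here, so that deleting rows and columns needs no renumbering.
\<close>

definition char_subpoly :: "('b \<times> 'b \<Rightarrow> 'a::comm_ring_1) \<Rightarrow> 'b set \<Rightarrow> 'a poly" where
  "char_subpoly a S = subdet (char_entry a) S"

lemma char_poly_eq_char_subpoly:
  assumes "A \<in> carrier_mat n n"
  shows "char_poly A = char_subpoly (($$) A) {0..<n}"
proof -
  have "char_poly_matrix A $$ (i, p i) = char_entry (($$) A) (i, p i)"
    if "p permutes {0..<n}" "i < n" for p i
  proof -
    have "p i < n" using permutes_in_image[OF that(1), of i] that(2) by simp
    thus ?thesis using that assms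
      by (auto simp: char_poly_matrix_def char_entry_def one_mat_def)
  qed
  moreover have "char_poly_matrix A \<in> carrier_mat n n"
    using assms by (rule char_poly_matrix_closed)
  ultimately show ?thesis
    unfolding char_poly_def char_subpoly_def subdet_def
    by (subst det_def') (auto intro!: sum.cong prod.cong arg_cong2[where f = "(*)"])
qed

lemma length_path_arcs [simp]: "length (path_arcs u ws v) = Suc (length ws)"
  by (induction u ws v rule: path_arcs.induct) auto

lemma path_arcs_snoc: "path_arcs u (ws @ [w]) v = path_arcs u ws w @ [(w, v)]"
  by (induction u ws v rule: path_arcs.induct) auto

lemma path_arcs_loop_free:
  assumes "distinct (u # ws)" "v \<notin> set ws" "ws \<noteq> [] \<or> u \<noteq> v" "e \<in> set (path_arcs u ws v)"
  shows "fst e \<noteq> snd e"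
  using assms by (induction u ws v rule: path_arcs.induct) auto

lemma weight_simps [simp]:
  "weight M [] = 1" "weight M (e # p) = M e * weight M p"
  "weight M (p @ q) = weight M p * weight M q"
  by (auto simp: weight_def)

lemma weight_char_entry:
  assumes "\<And>e. e \<in> set p \<Longrightarrow> fst e \<noteq> snd e"
  shows "weight (char_entry a) p = smult (weight a p) ((-1) ^ length p)"
  using assms
proof (induction p)
  case Nil
  show ?case by simp
next
  case (Cons e p)
  have "char_entry a e = [:- a e:]" using Cons.prems[of e] by (simp add: char_entry_def)
  with Cons show ?case by (simp add: mult.commute)
qed

definition cycle_weight :: "('b \<times> 'b \<Rightarrow> 'a::comm_monoid_mult) \<Rightarrow> 'b \<Rightarrow> 'b list \<Rightarrow> 'a" where
  "cycle_weight a v ws = weight a (path_arcs v ws v)"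

text \<open>
  A cycle with \<open>length ws + 1\<close> arcs contributes \<open>(-1) ^ length ws\<close> from the sign of the permutation and
  \<open>(-1) ^ (length ws + 1)\<close> from the entries \<open>- a e\<close>, so every cycle other than the fixed point \<open>v\<close>
  enters with a minus sign. The fixed point contributes the diagonal entry, the indeterminate.
\<close>

lemma char_subpoly_insert:
  assumes fin: "finite T" and v: "v \<notin> T" and diag: "a (v, v) = 0"
  shows "char_subpoly a (insert v T) = pCons 0 (char_subpoly a T) -
    (\<Sum>ws\<in>simple_lists T - {[]}. smult (cycle_weight a v ws) (char_subpoly a (T - set ws)))"
proof -
  have cycle_term: "(-1) ^ length ws * weight (char_entry a) (path_arcs v ws v) *
      subdet (char_entry a) (T - set ws) =
      - smult (cycle_weight a v ws) (char_subpoly a (T - set ws))"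
    if "ws \<in> simple_lists T - {[]}" for ws
  proof -
    have "distinct (v # ws)" "v \<notin> set ws" "ws \<noteq> []"
      using that v by (auto simp: simple_lists_def)
    hence "weight (char_entry a) (path_arcs v ws v) =
        smult (cycle_weight a v ws) ((-1) ^ Suc (length ws))"
      using weight_char_entry[of "path_arcs v ws v" a] path_arcs_loop_free[of v ws v]
      by (auto simp: cycle_weight_def)
    moreover have "(-1) ^ length ws * smult c ((-1) ^ Suc (length ws)) = smult c (-1)" for c :: 'b
      by (simp add: power_add[symmetric] mult_2[symmetric])
    ultimately have "(-1) ^ length ws * weight (char_entry a) (path_arcs v ws v) =
        smult (cycle_weight a v ws) (-1)" by (simp only:)
    thus ?thesis by (simp only:) (simp add: char_subpoly_def)
  qed
  have "char_subpoly a (insert v T) = (\<Sum>ws\<in>simple_lists T.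
      (-1) ^ length ws * weight (char_entry a) (path_arcs v ws v) *
      subdet (char_entry a) (T - set ws))"
    unfolding char_subpoly_def by (rule subdet_insert_eq_sum_cycles[OF fin v])
  also have "\<dots> = char_entry a (v, v) * char_subpoly a T + (\<Sum>ws\<in>simple_lists T - {[]}.
      (-1) ^ length ws * weight (char_entry a) (path_arcs v ws v) *
      subdet (char_entry a) (T - set ws))"
    using fin by (subst sum.remove[of _ "[]"]) (auto simp: char_subpoly_def)
  also have "char_entry a (v, v) * char_subpoly a T = pCons 0 (char_subpoly a T)"
    by (simp add: char_entry_def diag)
  also have "(\<Sum>ws\<in>simple_lists T - {[]}.
      (-1) ^ length ws * weight (char_entry a) (path_arcs v ws v) *
      subdet (char_entry a) (T - set ws)) = - (\<Sum>ws\<in>simple_lists T - {[]}.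
      smult (cycle_weight a v ws) (char_subpoly a (T - set ws)))"
    unfolding sum_negf[symmetric] by (rule sum.cong[OF refl cycle_term])
  finally show ?thesis by simp
qed

lemma char_subpoly_empty [simp]: "char_subpoly a {} = 1"
  by (simp add: char_subpoly_def subdet_def)

lemma card_Diff_simple_list:
  assumes "finite T" "ws \<in> simple_lists T"
  shows "card (T - set ws) + length ws = card T"
proof -
  have "set ws \<subseteq> T" "card (set ws) = length ws"
    using assms by (auto simp: simple_lists_def distinct_card)
  thus ?thesis using assms(1) card_mono[of T "set ws"] by (simp add: card_Diff_subset)
qed

lemma coeff_char_subpoly:
  assumes "finite S" "\<forall>v\<in>S. a (v, v) = 0" "card S \<le> j"
  shows "coeff (char_subpoly a S) j = (if j = card S then 1 else 0)"
  using assms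
proof (induction "card S" arbitrary: S j rule: less_induct)
  case less
  show ?case
  proof (cases "S = {}")
    case True
    thus ?thesis by simp
  next
    case False
    then obtain v T where S: "S = insert v T" and v: "v \<notin> T" by (metis Set.set_insert ex_in_conv)
    have fin: "finite T" and card: "card S = Suc (card T)" using less.prems v S by auto
    then obtain i where i: "j = Suc i" "card T \<le> i" using less.prems(3) by (cases j) auto
    have "coeff (char_subpoly a (T - set ws)) j = 0" if "ws \<in> simple_lists T - {[]}" for ws
    proof -
      have "card (T - set ws) \<le> card T" using fin by (simp add: card_mono)
      thus ?thesis using less.hyps[of "T - set ws" j] less.prems fin i card S by auto
    qed
    moreover have "coeff (char_subpoly a T) i = (if i = card T then 1 else 0)"
      using less.hyps[of T i] less.prems fin i card S by auto
    ultimately show ?thesis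
      using less.prems S char_subpoly_insert[OF fin v, of a] i card by (simp add: coeff_sum)
  qed
qed

section \<open>Hermitian matrices: only real parts of cycle weights matter\<close>

definition hermitian_on :: "'b set \<Rightarrow> ('b \<times> 'b \<Rightarrow> complex) \<Rightarrow> bool" where
  "hermitian_on V a \<longleftrightarrow>
     (\<forall>v\<in>V. a (v, v) = 0) \<and> (\<forall>u\<in>V. \<forall>v\<in>V. a (v, u) = cnj (a (u, v)))"

lemma hermitian_onD:
  assumes "hermitian_on V a"
  shows "v \<in> V \<Longrightarrow> a (v, v) = 0" and "u \<in> V \<Longrightarrow> v \<in> V \<Longrightarrow> a (v, u) = cnj (a (u, v))"
  using assms unfolding hermitian_on_def by blast+

lemma weight_rev:
  assumes "hermitian_on V a" "u \<in> V" "v \<in> V" "set ws \<subseteq> V"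
  shows "weight a (path_arcs v (rev ws) u) = cnj (weight a (path_arcs u ws v))"
  using assms(2,4)
proof (induction ws arbitrary: u)
  case Nil
  show ?case using hermitian_onD(2)[OF assms(1) Nil(1) assms(3)] by simp
next
  case (Cons w ws)
  have "a (w, u) = cnj (a (u, w))" using Cons.prems by (intro hermitian_onD(2)[OF assms(1)]) auto
  thus ?case using Cons.IH[of w] Cons.prems by (simp add: path_arcs_snoc)
qed

text \<open>
  Reversing \<open>ws\<close> conjugates the weight of a cycle of a Hermitian matrix and keeps its cofactor, so the
  average of the expansion and its reversal only sees the real parts.
\<close>

lemma char_subpoly_insert_Re:
  assumes fin: "finite T" and v: "v \<notin> T" and herm: "hermitian_on (insert v T) a"
  shows "char_subpoly a (insert v T) = pCons 0 (char_subpoly a T) -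
    (\<Sum>ws\<in>simple_lists T - {[]}.
       smult (of_real (Re (cycle_weight a v ws))) (char_subpoly a (T - set ws)))"
proof -
  let ?L = "simple_lists T - {[]}" and ?P = "\<lambda>ws. char_subpoly a (T - set ws)"
  let ?c = "cycle_weight a v"
  have "(\<Sum>ws\<in>?L. smult (?c ws) (?P ws)) = (\<Sum>ws\<in>?L. smult (?c (rev ws)) (?P (rev ws)))"
    by (rule sum.reindex_bij_witness[of _ rev rev]) (auto simp: simple_lists_def)
  also have "\<dots> = (\<Sum>ws\<in>?L. smult (cnj (?c ws)) (?P ws))"
  proof (rule sum.cong[OF refl])
    fix ws assume "ws \<in> ?L"
    hence "?c (rev ws) = cnj (?c ws)"
      unfolding cycle_weight_def
      by (intro weight_rev[OF herm]) (auto simp: simple_lists_def)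
    thus "smult (?c (rev ws)) (?P (rev ws)) = smult (cnj (?c ws)) (?P ws)" by simp
  qed
  finally have "smult 2 (\<Sum>ws\<in>?L. smult (?c ws) (?P ws)) =
      (\<Sum>ws\<in>?L. smult (?c ws) (?P ws)) + (\<Sum>ws\<in>?L. smult (cnj (?c ws)) (?P ws))"
    using smult_add_left[of 1 1 "\<Sum>ws\<in>?L. smult (?c ws) (?P ws)"] by simp
  also have "\<dots> = (\<Sum>ws\<in>?L. smult (?c ws + cnj (?c ws)) (?P ws))"
    by (simp add: smult_add_left sum.distrib)
  also have "\<dots> = smult 2 (\<Sum>ws\<in>?L. smult (of_real (Re (?c ws))) (?P ws))"
    by (simp add: complex_add_cnj smult_sum2)
  finally have "(\<Sum>ws\<in>?L. smult (?c ws) (?P ws)) =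
      (\<Sum>ws\<in>?L. smult (of_real (Re (?c ws))) (?P ws))"
    by (auto dest: arg_cong[where f = "smult (1 / 2)"])
  moreover have "a (v, v) = 0" using hermitian_onD(1)[OF herm] by simp
  ultimately show ?thesis using char_subpoly_insert[OF fin v, of a] by simp
qed

section \<open>Comparison of the coefficients of two characteristic polynomials\<close>

lemma hermitian_on_subset: "hermitian_on V a \<Longrightarrow> S \<subseteq> V \<Longrightarrow> hermitian_on S a"
  unfolding hermitian_on_def by blast

lemma coeff_char_subpoly_hermitian:
  assumes "finite S" "hermitian_on S a" "card S \<le> j"
  shows "coeff (char_subpoly a S) j = (if j = card S then 1 else 0)"
  using coeff_char_subpoly[of S a j] assms hermitian_onD(1)[OF assms(2)] by blast

text \<open>
  In the recursion for \<open>S\<close>, a cycle with at least \<open>k\<close> vertices leaves a cofactor of degree at most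
  \<open>card S - k\<close>, too small to reach coefficient \<open>j\<close>. Only shorter cycles contribute, and for these both
  the real part and, by induction, the coefficient of the cofactor agree. Digons count as cycles
  here.
\<close>

lemma coeff_char_subpoly_eq_if_short_cycles_agree:
  assumes fin: "finite V" and herm: "hermitian_on V a" "hermitian_on V b"
    and short: "\<And>v ws. distinct (v # ws) \<Longrightarrow> set (v # ws) \<subseteq> V \<Longrightarrow> ws \<noteq> [] \<Longrightarrow>
      length (v # ws) < k \<Longrightarrow> Re (cycle_weight a v ws) = Re (cycle_weight b v ws)"
    and S: "S \<subseteq> V" and j: "card S < j + k"
  shows "coeff (char_subpoly a S) j = coeff (char_subpoly b S) j"
  using S j
proof (induction "card S" arbitrary: S j rule: less_induct)
  case less
  show ?case
  proof (cases "S = {}")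
    case True
    thus ?thesis by simp
  next
    case False
    then obtain v T where S: "S = insert v T" and v: "v \<notin> T" by (metis Set.set_insert ex_in_conv)
    have finS: "finite S" using less.prems fin finite_subset by blast
    hence finT: "finite T" and card: "card S = Suc (card T)" using v S by auto
    have hS: "hermitian_on S a" "hermitian_on S b"
      using herm less.prems(1) hermitian_on_subset by blast+
    have "of_real (Re (cycle_weight a v ws)) * coeff (char_subpoly a (T - set ws)) j =
        of_real (Re (cycle_weight b v ws)) * coeff (char_subpoly b (T - set ws)) j"
      if ws: "ws \<in> simple_lists T - {[]}" for ws
    proof (cases "length (v # ws) < k")
      case True
      have "card (T - set ws) + length ws = card T"
        using card_Diff_simple_list[OF finT] ws by blast
      hence "coeff (char_subpoly a (T - set ws)) j = coeff (char_subpoly b (T - set ws)) j"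
        by (intro less.hyps) (use less.prems card S in auto)
      moreover have "Re (cycle_weight a v ws) = Re (cycle_weight b v ws)"
        by (rule short) (use ws True v S less.prems in \<open>auto simp: simple_lists_def\<close>)
      ultimately show ?thesis by simp
    next
      case False
      have lt: "card (T - set ws) < j"
        using card_Diff_simple_list[OF finT, of ws] ws less.prems(2) False card by auto
      have "hermitian_on (T - set ws) a" "hermitian_on (T - set ws) b"
        using hS S by (auto elim!: hermitian_on_subset)
      thus ?thesis using lt finT by (simp add: coeff_char_subpoly_hermitian)
    qed
    moreover have "coeff (pCons 0 (char_subpoly a T)) j = coeff (pCons 0 (char_subpoly b T)) j"
    proof (cases j)
      case (Suc i)
      have "coeff (char_subpoly a T) i = coeff (char_subpoly b T) i"
        by (rule less.hyps) (use less.prems card S Suc in auto)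
      thus ?thesis using Suc by simp
    qed simp
    ultimately show ?thesis
      using char_subpoly_insert_Re[OF finT v] hS unfolding S by (simp add: coeff_sum)
  qed
qed

text \<open>
  In degree \<open>card S - k\<close> a cycle with \<open>k\<close> vertices meets exactly the leading coefficient of its cofactor,
  which is 1. So each cycle singled out by \<open>Q\<close> contributes \<open>- d\<close> to the difference, while all other
  contributions cancel. The number \<open>N\<close> counts the singled out cycles met in the recursion; what matters is
  that it is a natural number, positive as soon as there is such a cycle, because no cancellation
  can then hide \<open>d\<close>.
\<close>

lemma coeff_char_subpoly_diff:
  assumes fin: "finite V" and herm: "hermitian_on V a" "hermitian_on V b" and k: "2 \<le> k"
    and short: "\<And>v ws. distinct (v # ws) \<Longrightarrow> set (v # ws) \<subseteq> V \<Longrightarrow> ws \<noteq> [] \<Longrightarrow>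
      length (v # ws) < k \<Longrightarrow> Re (cycle_weight a v ws) = Re (cycle_weight b v ws)"
    and long: "\<And>v ws. distinct (v # ws) \<Longrightarrow> set (v # ws) \<subseteq> V \<Longrightarrow> length (v # ws) = k \<Longrightarrow>
      Re (cycle_weight a v ws) - Re (cycle_weight b v ws) = (if Q v ws then d else 0)"
    and S: "S \<subseteq> V" and j: "card S = j + k"
  shows "\<exists>N::nat. coeff (char_subpoly a S) j - coeff (char_subpoly b S) j = - (of_nat N * of_real d) \<and>
    ((\<exists>v ws. distinct (v # ws) \<and> set (v # ws) \<subseteq> S \<and> length (v # ws) = k \<and> Q v ws) \<longrightarrow> 0 < N)"
  using S j
proof (induction "card S" arbitrary: S j rule: less_induct)
  case less
  have finS: "finite S" using less.prems fin finite_subset by blast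
  have "S \<noteq> {}" using less.prems k by auto
  \<comment> \<open>The recursion may remove any vertex; removing one on a cycle of the required kind yields \<open>0 < N\<close>.\<close>
  then obtain v where vS: "v \<in> S"
    and vQ: "(\<exists>v ws. distinct (v # ws) \<and> set (v # ws) \<subseteq> S \<and> length (v # ws) = k \<and> Q v ws) \<longrightarrow>
      (\<exists>ws. distinct (v # ws) \<and> set (v # ws) \<subseteq> S \<and> length (v # ws) = k \<and> Q v ws)"
    by (metis ex_in_conv list.set_intros(1) subsetD)
  define T where "T = S - {v}"
  have S: "S = insert v T" and v: "v \<notin> T" using vS by (auto simp: T_def)
  have finT: "finite T" and card: "card S = Suc (card T)" using finS v S by auto
  have hS: "hermitian_on S a" "hermitian_on S b"
    using herm less.prems(1) hermitian_on_subset by blast+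
  define K where "K = {ws \<in> simple_lists T. length (v # ws) = k \<and> Q v ws}"
  let ?L = "simple_lists T - {[]}"
  have cycle_term: "of_real (Re (cycle_weight a v ws)) * coeff (char_subpoly a (T - set ws)) j -
      of_real (Re (cycle_weight b v ws)) * coeff (char_subpoly b (T - set ws)) j =
      (if ws \<in> K then of_real d else 0)"
    if ws: "ws \<in> ?L" for ws
  proof -
    have cardT: "card (T - set ws) + length ws = card T"
      using card_Diff_simple_list[OF finT] ws by blast
    have hT: "hermitian_on (T - set ws) a" "hermitian_on (T - set ws) b"
      using hS S by (auto elim!: hermitian_on_subset)
    have dist: "distinct (v # ws)" "set (v # ws) \<subseteq> V" "ws \<noteq> []"
      using ws v S less.prems by (auto simp: simple_lists_def)
    consider "length (v # ws) < k" | "length (v # ws) = k" | "length (v # ws) > k" by linarith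
    thus ?thesis
    proof cases
      case 1
      have "coeff (char_subpoly a (T - set ws)) j = coeff (char_subpoly b (T - set ws)) j"
        by (rule coeff_char_subpoly_eq_if_short_cycles_agree[OF fin herm short])
           (use 1 less.prems cardT card S ws in auto)
      with short[OF dist 1] 1 show ?thesis by (simp add: K_def)
    next
      case 2
      hence "j = card (T - set ws)" using cardT card less.prems by simp
      thus ?thesis using long[OF dist(1,2) 2] 2 finT hT ws
        by (simp add: coeff_char_subpoly_hermitian K_def flip: of_real_diff)
    next
      case 3
      hence "card (T - set ws) < j" using cardT card less.prems by simp
      thus ?thesis using 3 finT hT by (simp add: coeff_char_subpoly_hermitian K_def)
    qed
  qed
  have K: "finite K" "?L \<inter> K = K"
    using finT k by (auto simp: K_def)
  have "\<exists>N::nat. coeff (pCons 0 (char_subpoly a T)) j - coeff (pCons 0 (char_subpoly b T)) j =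
      - (of_nat N * of_real d)"
  proof (cases j)
    case 0
    thus ?thesis by (intro exI[of _ 0]) simp
  next
    case (Suc i)
    have "\<exists>N::nat. coeff (char_subpoly a T) i - coeff (char_subpoly b T) i =
        - (of_nat N * of_real d)"
      using less.hyps[of T i] less.prems card S Suc by auto
    thus ?thesis using Suc by simp
  qed
  then obtain N :: nat where N: "coeff (pCons 0 (char_subpoly a T)) j -
      coeff (pCons 0 (char_subpoly b T)) j = - (of_nat N * of_real d)" by blast
  have "coeff (char_subpoly a S) j - coeff (char_subpoly b S) j =
      (coeff (pCons 0 (char_subpoly a T)) j - coeff (pCons 0 (char_subpoly b T)) j) -
      (\<Sum>ws\<in>?L. of_real (Re (cycle_weight a v ws)) * coeff (char_subpoly a (T - set ws)) j -
        of_real (Re (cycle_weight b v ws)) * coeff (char_subpoly b (T - set ws)) j)"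
    using char_subpoly_insert_Re[OF finT v] hS unfolding S
    by (simp add: coeff_sum sum_subtractf)
  also have "(\<Sum>ws\<in>?L. of_real (Re (cycle_weight a v ws)) * coeff (char_subpoly a (T - set ws)) j -
        of_real (Re (cycle_weight b v ws)) * coeff (char_subpoly b (T - set ws)) j) =
      (\<Sum>ws\<in>?L. if ws \<in> K then of_real d else 0)"
    by (rule sum.cong[OF refl cycle_term])
  also have "\<dots> = of_nat (card K) * of_real d"
    using finT K by (simp flip: sum.inter_restrict)
  finally have "coeff (char_subpoly a S) j - coeff (char_subpoly b S) j =
      - (of_nat (N + card K) * of_real d)"
    unfolding N by (simp add: algebra_simps)
  moreover have "0 < N + card K"
    if ex: "\<exists>v ws. distinct (v # ws) \<and> set (v # ws) \<subseteq> S \<and> length (v # ws) = k \<and> Q v ws"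
  proof -
    obtain ws where "distinct (v # ws)" "set (v # ws) \<subseteq> S" "length (v # ws) = k" "Q v ws"
      using vQ ex by blast
    hence "ws \<in> K" unfolding K_def by (auto simp: simple_lists_def S)
    hence "0 < card K" using K(1) by (metis card_gt_0_iff empty_iff)
    thus ?thesis by simp
  qed
  ultimately show ?case by (intro exI[of _ "N + card K"] conjI impI)
qed

section \<open>Cycles of the graph of a matrix\<close>

lemma hermitian_on_hermitian_mats:
  assumes "A \<in> hermitian_mats n \<Gamma>"
  shows "hermitian_on {0..<n} (($$) A)"
  unfolding hermitian_on_def
proof (intro conjI ballI)
  fix u v assume "u \<in> {0..<n}" "v \<in> {0..<n}"
  thus "A $$ (v, u) = cnj (A $$ (u, v))" using hermitian_mats_entry[OF assms, of u v] by simp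
qed (use assms in \<open>auto simp: hermitian_mats_def\<close>)

lemma cas_path_arcs: "pre_digraph.cas (with_proj G) u (path_arcs u ws v) v"
  by (induction u ws v rule: path_arcs.induct) (auto simp: pre_digraph.cas.simps)

lemma awalk_verts_path_arcs:
  "pre_digraph.awalk_verts (with_proj G) u (path_arcs u ws v) = u # ws @ [v]"
  by (induction u ws v rule: path_arcs.induct) (auto simp: pre_digraph.awalk_verts.simps)

lemma cas_imp_path_arcs:
  assumes "pre_digraph.cas (with_proj G) u p v" "p \<noteq> []"
  shows "\<exists>ws. p = path_arcs u ws v"
  using assms
proof (induction p arbitrary: u)
  case (Cons e p)
  obtain w where e: "e = (u, w)" and p: "pre_digraph.cas (with_proj G) w p v"
    using Cons.prems(1) by (cases e) (auto simp: pre_digraph.cas.simps)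
  show ?case
  proof (cases "p = []")
    case True
    hence "e # p = path_arcs u [] v" using e p by (simp add: pre_digraph.cas.simps)
    thus ?thesis ..
  next
    case False
    then obtain ws where "p = path_arcs w ws v" using Cons.IH[OF p] by blast
    hence "e # p = path_arcs u (w # ws) v" using e by simp
    thus ?thesis ..
  qed
qed simp

lemma cycle_gain_path_arcs: "cycle_gain A (path_arcs v ws v) = cycle_weight (($$) A) v ws"
  by (simp add: cycle_gain_def cycle_weight_def weight_def)

lemma set_path_arcs_subset:
  "set (path_arcs u ws v) \<subseteq> insert u (set ws) \<times> insert v (set ws)"
  by (induction u ws v rule: path_arcs.induct) auto

lemma weight_eq_0_iff:
  "weight a p = (0 :: 'a :: idom) \<longleftrightarrow> (\<exists>e\<in>set p. a e = 0)"
  by (induction p) auto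

text \<open>
  An arc is present iff its entry is nonzero, so a closed simple path is a cycle of the graph iff its
  weight does not vanish. Two matrices with the same graph thus have the same vanishing cycle weights.
\<close>

lemma graph_cycle_path_arcs_iff:
  assumes A: "A \<in> carrier_mat n n" and ws: "distinct (v # ws)" "set (v # ws) \<subseteq> {0..<n}"
    and len: "2 \<le> length ws"
  shows "graph_cycle (graph_of_mat A) (path_arcs v ws v) \<longleftrightarrow> cycle_weight (($$) A) v ws \<noteq> 0"
proof -
  let ?G = "with_proj (graph_of_mat A)"
  have arcs: "arcs ?G = {(i, j). i < n \<and> j < n \<and> A $$ (i, j) \<noteq> 0}"
    and verts: "verts ?G = {0..<n}"
    using A by (auto simp: graph_of_mat_def)
  have "set (path_arcs v ws v) \<subseteq> {0..<n} \<times> {0..<n}"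
    using set_path_arcs_subset[of v ws v] ws(2) by fastforce
  hence nz: "cycle_weight (($$) A) v ws \<noteq> 0 \<longleftrightarrow> set (path_arcs v ws v) \<subseteq> arcs ?G"
    unfolding cycle_weight_def weight_eq_0_iff arcs by fastforce
  show ?thesis
  proof
    assume "graph_cycle (graph_of_mat A) (path_arcs v ws v)"
    thus "cycle_weight (($$) A) v ws \<noteq> 0"
      unfolding nz graph_cycle_def pre_digraph.cycle_def pre_digraph.awalk_def by blast
  next
    assume "cycle_weight (($$) A) v ws \<noteq> 0"
    hence "pre_digraph.awalk ?G v (path_arcs v ws v) v"
      using nz cas_path_arcs[of "graph_of_mat A" v ws v] ws verts
      by (simp add: pre_digraph.awalk_def)
    moreover have "distinct (tl (pre_digraph.awalk_verts ?G v (path_arcs v ws v)))"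
      using ws by (simp add: awalk_verts_path_arcs)
    moreover have "path_arcs v ws v \<noteq> []" by (cases ws) auto
    ultimately have "pre_digraph.cycle ?G (path_arcs v ws v)"
      unfolding pre_digraph.cycle_def by blast
    thus "graph_cycle (graph_of_mat A) (path_arcs v ws v)"
      using len by (simp add: graph_cycle_def)
  qed
qed

lemma graph_cycleE:
  assumes "A \<in> carrier_mat n n" "graph_cycle (graph_of_mat A) C"
  obtains v ws where "C = path_arcs v ws v" "distinct (v # ws)" "set (v # ws) \<subseteq> {0..<n}"
    "2 \<le> length ws"
proof -
  let ?G = "with_proj (graph_of_mat A)"
  obtain v where walk: "pre_digraph.awalk ?G v C v"
    and dist: "distinct (tl (pre_digraph.awalk_verts ?G v C))" and ne: "C \<noteq> []" and len: "3 \<le> length C"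
    using assms(2) unfolding graph_cycle_def pre_digraph.cycle_def by blast
  have "pre_digraph.cas ?G v C v" using walk by (simp add: pre_digraph.awalk_def)
  then obtain ws where C: "C = path_arcs v ws v"
    using cas_imp_path_arcs[OF _ ne] by blast
  have inV: "w \<in> {0..<n}" if "w \<in> set ws" for w
  proof -
    have "\<exists>x. (x, w) \<in> set (path_arcs v ws z)" for z
      using that by (induction v ws z rule: path_arcs.induct) auto
    then obtain x where "(x, w) \<in> set C" using C by blast
    moreover have "set C \<subseteq> arcs ?G" using walk by (simp add: pre_digraph.awalk_def)
    ultimately show ?thesis using assms(1) by (auto simp: graph_of_mat_def)
  qed
  have "v \<in> {0..<n}" using walk assms(1) by (simp add: pre_digraph.awalk_def graph_of_mat_def)
  hence "set (v # ws) \<subseteq> {0..<n}" using inV by auto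
  moreover have "distinct (v # ws)" using dist by (simp add: C awalk_verts_path_arcs)
  ultimately show thesis using that[OF C] len C by simp
qed

section \<open>Cospectrality and gains of cycles\<close>

lemma gain_set_norm:
  assumes "gain_set \<Gamma>" "z \<in> \<Gamma>" "z \<noteq> 0"
  shows "cmod z = 1"
proof -
  have "\<Gamma> - {0} \<subseteq> carrier unit_complex_group"
    using assms(1) unfolding gain_set_def by (blast dest: subgroup.subset)
  thus ?thesis using assms(2,3) by (auto simp: unit_complex_group_def)
qed

text \<open>
  This is where the unit modulus of the gains enters: a digon, the contribution of a single edge,
  carries no information beyond the graph.
\<close>

lemma cycle_weight_digon:
  assumes "gain_set \<Gamma>" "A \<in> hermitian_mats n \<Gamma>" "u < n" "v < n"
  shows "cycle_weight (($$) A) u [v] = (if A $$ (u, v) = 0 then 0 else 1)"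
proof -
  have "A $$ (u, v) \<in> \<Gamma>"
    using assms(2-4) elements_matI[of A n n u v] unfolding hermitian_mats_def by blast
  hence "cmod (A $$ (u, v)) = 1" if "A $$ (u, v) \<noteq> 0"
    using gain_set_norm[OF assms(1)] that by blast
  thus ?thesis
    using hermitian_mats_entry[OF assms(2-4)]
    by (simp add: cycle_weight_def complex_norm_square[symmetric])
qed

text \<open>
  Over the complex numbers a monic polynomial is determined by the multiset of its roots.
\<close>

lemma cospectral_iff_char_poly_eq:
  assumes "A \<in> carrier_mat n n" "B \<in> carrier_mat n n"
  shows "cospectral A B \<longleftrightarrow> char_poly A = char_poly B"
proof -
  have "char_poly M = (\<Prod>x\<in>#eigenvalue_mset M. [:- x, 1:])" if "M \<in> carrier_mat n n" for M
    using complex_poly_decompose_multiset[of "char_poly M"] degree_monic_char_poly[OF that]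
    by (simp add: eigenvalue_mset_def)
  thus ?thesis using assms unfolding cospectral_def by (metis eigenvalue_mset_def)
qed

theorem theorem2p14:
  fixes \<Gamma> :: "complex set" and n :: nat and A B :: "complex mat"
    and G :: "nat pair_pre_digraph"
  assumes "gain_set \<Gamma>"
    and "A \<in> hermitian_mats n \<Gamma>" and "B \<in> hermitian_mats n \<Gamma>"
    and "graph_of_mat A = G" and "graph_of_mat B = G"
    and "\<And>C\<^sub>1 C\<^sub>2. graph_cycle G C\<^sub>1 \<Longrightarrow> graph_cycle G C\<^sub>2 \<Longrightarrow> length C\<^sub>1 = length C\<^sub>2 \<Longrightarrow>
           Re (cycle_gain A C\<^sub>1) = Re (cycle_gain A C\<^sub>2) \<and>
           Re (cycle_gain B C\<^sub>1) = Re (cycle_gain B C\<^sub>2)"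
  shows "cospectral A B \<longleftrightarrow>
           (\<forall>C. graph_cycle G C \<longrightarrow> Re (cycle_gain A C) = Re (cycle_gain B C))"
proof -
  have cA: "A \<in> carrier_mat n n" and cB: "B \<in> carrier_mat n n"
    using assms(2,3) by (auto simp: hermitian_mats_def)
  note herm = assms(2,3)[THEN hermitian_on_hermitian_mats]
  let ?V = "{0..<n}" and ?a = "($$) A" and ?b = "($$) B"
  have zero_iff: "A $$ (u, v) = 0 \<longleftrightarrow> B $$ (u, v) = 0" if "u < n" "v < n" for u v
  proof -
    have "parcs (graph_of_mat A) = parcs (graph_of_mat B)" using assms(4,5) by simp
    thus ?thesis using that cA cB by (auto simp: graph_of_mat_def)
  qed
  have agree: "Re (cycle_weight ?a v ws) = Re (cycle_weight ?b v ws)"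
    if shorter: "\<And>C. graph_cycle G C \<Longrightarrow> length C < k \<Longrightarrow> Re (cycle_gain A C) = Re (cycle_gain B C)"
      and ws: "distinct (v # ws)" "set (v # ws) \<subseteq> ?V" "ws \<noteq> []" "length (v # ws) < k"
    for k v ws
  proof (cases "2 \<le> length ws")
    case True
    note iff = graph_cycle_path_arcs_iff[OF cA ws(1,2) True] graph_cycle_path_arcs_iff[OF cB ws(1,2) True]
    show ?thesis
    proof (cases "graph_cycle G (path_arcs v ws v)")
      case True
      thus ?thesis using shorter[of "path_arcs v ws v"] ws(4) by (simp add: cycle_gain_path_arcs)
    next
      case False
      thus ?thesis using iff assms(4,5) by simp
    qed
  next
    case False
    then obtain w where "ws = [w]" using ws(3) by (cases ws) (auto simp: Suc_le_eq)
    thus ?thesis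
      using ws(2) zero_iff assms(1-3) by (simp add: cycle_weight_digon)
  qed
  have iff_char: "cospectral A B \<longleftrightarrow> char_subpoly ?a ?V = char_subpoly ?b ?V"
    using cospectral_iff_char_poly_eq[OF cA cB]
    by (simp add: char_poly_eq_char_subpoly[OF cA] char_poly_eq_char_subpoly[OF cB])
  show ?thesis
  proof
    assume all: "\<forall>C. graph_cycle G C \<longrightarrow> Re (cycle_gain A C) = Re (cycle_gain B C)"
    \<comment> \<open>A cycle has at most \<open>n\<close> vertices, so with \<open>k = n + 1\<close> all cycles are short and all coefficients are covered.\<close>
    have "coeff (char_subpoly ?a ?V) j = coeff (char_subpoly ?b ?V) j" for j
      by (rule coeff_char_subpoly_eq_if_short_cycles_agree[where k = "Suc n", OF _ herm agree])
         (use all in auto)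
    thus "cospectral A B" unfolding iff_char by (rule poly_eqI)
  next
    assume "cospectral A B"
    hence eq: "char_subpoly ?a ?V = char_subpoly ?b ?V" using iff_char by blast
    have "Re (cycle_gain A C) = Re (cycle_gain B C)" if "graph_cycle G C" for C
      using that
    proof (induction "length C" arbitrary: C rule: less_induct)
      case less
      obtain v ws where C: "C = path_arcs v ws v" and ws: "distinct (v # ws)" "set (v # ws) \<subseteq> ?V"
        and len: "2 \<le> length ws"
        using graph_cycleE[OF cA] less.prems assms(4) by metis
      define k where "k = length C"
      define d where "d = Re (cycle_gain A C) - Re (cycle_gain B C)"
      have k: "k = Suc (length ws)" by (simp add: k_def C)
      have "card (set (v # ws)) \<le> n" using card_mono[OF _ ws(2)] by simp
      hence "k \<le> n" using ws(1) k by (simp add: distinct_card)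
      \<comment> \<open>The coefficient in which the cycles with \<open>k\<close> vertices appear for the first time.\<close>
      then obtain j where j: "n = j + k" by (metis le_add_diff_inverse2)
      have long: "Re (cycle_weight ?a v' ws') - Re (cycle_weight ?b v' ws') =
          (if cycle_weight ?a v' ws' \<noteq> 0 then d else 0)"
        if ws': "distinct (v' # ws')" "set (v' # ws') \<subseteq> ?V" "length (v' # ws') = k" for v' ws'
      proof -
        have len': "2 \<le> length ws'" using ws'(3) k len by simp
        note iff = graph_cycle_path_arcs_iff[OF cA ws'(1,2) len'] graph_cycle_path_arcs_iff[OF cB ws'(1,2) len']
        show ?thesis
        proof (cases "cycle_weight ?a v' ws' = 0")
          case True
          thus ?thesis using iff assms(4,5) by simp
        next
          case False
          hence "graph_cycle G (path_arcs v' ws' v')" using iff assms(4) by simp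
          hence "Re (cycle_gain A (path_arcs v' ws' v')) = Re (cycle_gain A C) \<and>
              Re (cycle_gain B (path_arcs v' ws' v')) = Re (cycle_gain B C)"
            using less.prems ws'(3) by (intro assms(6)) (auto simp: k_def)
          thus ?thesis using False by (simp add: d_def cycle_gain_path_arcs)
        qed
      qed
      have "\<exists>N::nat. coeff (char_subpoly ?a ?V) j - coeff (char_subpoly ?b ?V) j =
          - (of_nat N * of_real d) \<and>
          ((\<exists>v ws. distinct (v # ws) \<and> set (v # ws) \<subseteq> ?V \<and> length (v # ws) = k \<and>
            cycle_weight ?a v ws \<noteq> 0) \<longrightarrow> 0 < N)"
        by (rule coeff_char_subpoly_diff[OF _ herm _ agree[where k = k] long])
           (use less.hyps k len j in \<open>auto simp: k_def\<close>)
      then obtain N :: nat where N: "of_nat N * complex_of_real d = 0"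
        and pos: "(\<exists>v ws. distinct (v # ws) \<and> set (v # ws) \<subseteq> ?V \<and> length (v # ws) = k \<and>
            cycle_weight ?a v ws \<noteq> 0) \<longrightarrow> 0 < N"
        using eq by auto
      have "cycle_weight ?a v ws \<noteq> 0"
        using graph_cycle_path_arcs_iff[OF cA ws len] less.prems C assms(4) by simp
      hence "0 < N" using pos ws k by (metis length_Cons)
      thus ?case using N by (simp add: d_def)
    qed
    thus "\<forall>C. graph_cycle G C \<longrightarrow> Re (cycle_gain A C) = Re (cycle_gain B C)" by blast
  qed
qed

end
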